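(* Let $A,B\in\mathbb{C}^{n\times n}$ be such that for each $i\in\{1,\dots,n\}$ the $i$th row of at least one of $A$ and $B$ is strictly diagonally dominant. For $1\le i\le n$ put $\Gamma_i(A,B)=\Gamma_i^B(A,B)\cap\Gamma_i^A(A,B)$, where the regions $\Gamma_i^B(A,B)$ and $\Gamma_i^A(A,B)$ are those defined in the context. Then all the eigenvalues (finite or infinite) of the pencil $A-\lambda B$ lie in the union of the $n$ regions $\Gamma_i(A,B)$; that is, if $\lambda\in\mathbb{C}\cup\{\infty\}$ is an eigenvalue of the pencil, then $\lambda\in\Gamma(A,B):=\bigcup_{1\le i\le n}\Gamma_i(A,B)$.
   Context: Write $A=(a_{i,j})$, $B=(b_{i,j})$. The $i$th row of a matrix $M=(m_{i,j})$ is strictly diagonally dominant if $|m_{i,i}|>\sum_{j\ne i}|m_{i,j}|$. Eigenvalues: $\lambda\in\mathbb{C}$ is a finite eigenvalue of the pencil $A-\lambda B$ if $\det(A-\lambda B)=0$ (equivalently $A\bm{x}=\lambda B\bm{x}$ for some $\bm{x}\neq 0$). If the polynomial $\det(A-\lambda B)$ has degree $d<n$, the pencil has $n-d$ infinite eigenvalues; $\infty$ is an eigenvalue exactly when $B\bm{x}=0$ for some $\bm{x}\ne0$. All regions are subsets of the extended plane $\mathbb{C}\cup\{\infty\}$. Let $S^B$ (resp. $S^A$) be the set of $i$ such that the $i$th row of $B$ (resp. $A$) is strictly diagonally dominant. Definition of $\Gamma_i^B(A,B)$. For $i\in S^B$ let $r_i=\sum_{j\ne i}|b_{i,j}|/|b_{i,i}|\;(<1)$,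 $R_i=\sum_{j\neq i}|a_{i,j}|$, $\rho_i=\frac{|a_{i,i}|r_i+R_i}{|b_{i,i}|(1-r_i)}$, and $\Gamma_i^B(A,B)=\{z\in\mathbb{C}:|z-a_{i,i}/b_{i,i}|\le\rho_i\}$. For $i\notin S^B$, $\Gamma_i^B(A,B)$ is the whole plane, including the point $\infty$. Definition of $\Gamma_i^A(A,B)$. For $i\in S^A$ let $r_i^A=\sum_{j\ne i}|a_{i,j}|/|a_{i,i}|\;(<1)$ and $R_i^A=\sum_{j\ne i}|b_{i,j}|$. If $b_{i,i}=R_i^A=0$, then $\Gamma_i^A(A,B)=\{\infty\}$. If $b_{i,i}=0$ and $R_i^A>0$, then $\Gamma_i^A(A,B)=\{z\in\mathbb{C}:|z|\ge\frac{|a_{i,i}|}{R_i^A}(1-r_i^A)\}\cup\{\infty\}$. If $b_{i,i}\ne0$, let $\alpha_i=\frac{a_{i,i}}{b_{i,i}}$, $\beta_i=\frac{|b_{i,i}|r_i^A+R_i^A}{|b_{i,i}|(1-r_i^A)}$ and, when $\beta_i\neq1$, $c_i=\frac{\alpha_i}{1-\beta_i^2}$, $\rho_i^A=\frac{|\alpha_i|\beta_i}{|1-\beta_i^2|}$; then: if $\beta_i<1$, $\Gamma_i^A(A,B)=\{z\in\mathbb{C}:|z-c_i|\le\rho_i^A\}$; if $\beta_i>1$, $\Gamma_i^A(A,B)=\{z\in\mathbb{C}:|z-c_i|\ge\rho_i^A\}\cup\{\infty\}$; if $\beta_i=1$, $\Gamma_i^A(A,B)=\{z\in\mathbb{C}:|z-\alpha_i|\le|z|\}\cup\{\infty\}$.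 For $i\notin S^A$, $\Gamma_i^A(A,B)$ is the whole plane, including the point $\infty$. *)

theory Defs
  imports "HOL-Analysis.Analysis" "HOL-Computational_Algebra.Polynomial"
begin

text \<open>The extended plane: the complex numbers together with one point at infinity.\<close>

datatype ext_complex = Fin complex | Infty

definition off_diag_sum :: "complex^'n^'n \<Rightarrow> 'n \<Rightarrow> real" where
  "off_diag_sum M i = (\<Sum>j\<in>UNIV - {i}. cmod (M $ i $ j))"

definition row_sdd :: "complex^'n^'n \<Rightarrow> 'n \<Rightarrow> bool" where
  "row_sdd M i \<longleftrightarrow> cmod (M $ i $ i) > off_diag_sum M i"

definition pencil :: "complex^'n^'n \<Rightarrow> complex^'n^'n \<Rightarrow> complex \<Rightarrow> complex^'n^'n" where
  "pencil A B l = (\<chi> i j. A $ i $ j - l * B $ i $ j)"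

text \<open>The polynomial \<open>det (A - \<lambda> B)\<close> in the indeterminate \<open>\<lambda>\<close>: a determinant over \<open>\<complex>[\<lambda>]\<close>.\<close>

definition pencil_poly :: "complex^'n^'n \<Rightarrow> complex^'n^'n \<Rightarrow> complex poly" where
  "pencil_poly A B = det (\<chi> i j. [: A $ i $ j, - (B $ i $ j) :])"

text \<open>
  There are \<open>n - d\<close> infinite eigenvalues, where \<open>d\<close> is the degree of \<open>det (A - \<lambda> B)\<close>, so the
  point at infinity is an eigenvalue iff \<open>d < n\<close>. The coefficient of \<open>\<lambda>^n\<close> is, up to sign,
  \<open>det B\<close>, so this is the same as \<open>B\<close> having a nonzero null vector. Singular pencils are not
  excluded: there the polynomial is zero and has degree \<open>0 < n\<close>, and \<open>B\<close> is singular, so the two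
  descriptions still agree and every point of the extended plane is an eigenvalue.
\<close>

fun pencil_eigenvalue :: "complex^'n^'n \<Rightarrow> complex^'n^'n \<Rightarrow> ext_complex \<Rightarrow> bool" where
  "pencil_eigenvalue A B (Fin l) \<longleftrightarrow> det (pencil A B l) = 0"
| "pencil_eigenvalue (A :: complex^'n^'n) B Infty \<longleftrightarrow> degree (pencil_poly A B) < CARD('n)"

definition Gamma_B :: "complex^'n^'n \<Rightarrow> complex^'n^'n \<Rightarrow> 'n \<Rightarrow> ext_complex set" where
  "Gamma_B A B i =
    (if row_sdd B i then
       let a = A $ i $ i; b = B $ i $ i;
           r = off_diag_sum B i / cmod b;
           R = off_diag_sum A i;
           \<rho> = (cmod a * r + R) / (cmod b * (1 - r))
       in Fin ` {z. cmod (z - a / b) \<le> \<rho>}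
     else UNIV)"

definition Gamma_A :: "complex^'n^'n \<Rightarrow> complex^'n^'n \<Rightarrow> 'n \<Rightarrow> ext_complex set" where
  "Gamma_A A B i =
    (if row_sdd A i then
       let a = A $ i $ i; b = B $ i $ i;
           r = off_diag_sum A i / cmod a;
           R = off_diag_sum B i
       in if b = 0 then
            (if R = 0 then {Infty}
             else Fin ` {z. cmod z \<ge> cmod a / R * (1 - r)} \<union> {Infty})
          else
            let \<alpha> = a / b;
                \<beta> = (cmod b * r + R) / (cmod b * (1 - r));
                c = \<alpha> / of_real (1 - \<beta>\<^sup>2);
                \<rho> = cmod \<alpha> * \<beta> / \<bar>1 - \<beta>\<^sup>2\<bar>
            in if \<beta> < 1 then Fin ` {z. cmod (z - c) \<le> \<rho>}
               else if \<beta> > 1 then Fin ` {z. cmod (z - c) \<ge> \<rho>} \<union> {Infty}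
               else Fin ` {z. cmod (z - \<alpha>) \<le> cmod z} \<union> {Infty}
     else UNIV)"

definition Gamma_region :: "complex^'n^'n \<Rightarrow> complex^'n^'n \<Rightarrow> 'n \<Rightarrow> ext_complex set" where
  "Gamma_region A B i = Gamma_B A B i \<inter> Gamma_A A B i"

end

theory Submission
  imports Defs
begin

text \<open>
  Both regions of row \<open>i\<close> are consequences of one inequality: if \<open>A - \<lambda> B\<close> is singular, then by
  the Levy--Desplanques theorem some row \<open>i\<close> of it is not strictly diagonally dominant, so that
  \<open>\<bar>a - \<lambda> b\<bar> \<le> R + \<bar>\<lambda>\<bar> R'\<close>, where \<open>a\<close>, \<open>b\<close> are the diagonal entries and \<open>R\<close>, \<open>R'\<close> the off-diagonal
  sums of the rows of \<open>A\<close> and \<open>B\<close>. Eliminating \<open>\<bar>\<lambda>\<bar>\<close> through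
  \<open>\<bar>\<lambda>\<bar> \<le> \<bar>\<lambda> - a/b\<bar> + \<bar>a/b\<bar>\<close> gives the disk of \<open>B\<close>; eliminating \<open>\<bar>a/b\<bar>\<close> through
  \<open>\<bar>a/b\<bar> \<le> \<bar>\<lambda> - a/b\<bar> + \<bar>\<lambda>\<bar>\<close> gives \<open>\<bar>\<lambda> - \<alpha>\<bar> \<le> \<beta> \<bar>\<lambda>\<bar>\<close>, which the circles of Apollonius turn into
  the region of \<open>A\<close>. At infinity the same theorem is applied to \<open>- B\<close>.
\<close>

lemma off_diag_sum_nonneg: "0 \<le> off_diag_sum M i"
  by (simp add: off_diag_sum_def sum_nonneg)

text \<open>These signs make \<open>cmod b * (1 - r)\<close>, the denominator of both radii,
  positive, so that it can be divided by.\<close>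

lemma row_sdd_ratio:
  assumes "row_sdd M i"
  shows "0 < cmod (M $ i $ i)" "0 \<le> off_diag_sum M i / cmod (M $ i $ i)"
    "off_diag_sum M i / cmod (M $ i $ i) < 1"
proof -
  show pos: "0 < cmod (M $ i $ i)"
    using assms off_diag_sum_nonneg[of M i] unfolding row_sdd_def by linarith
  show "0 \<le> off_diag_sum M i / cmod (M $ i $ i)"
    by (simp add: off_diag_sum_nonneg)
  show "off_diag_sum M i / cmod (M $ i $ i) < 1"
    using assms pos by (simp add: row_sdd_def)
qed

text \<open>Take a nonzero null vector \<open>x\<close> and the index \<open>i\<close> of an entry
  of largest modulus. In row \<open>i\<close> of \<open>M *v x = 0\<close>, every other
  \<open>cmod (x $ j)\<close> is bounded by \<open>cmod (x $ i) > 0\<close>, which then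
  cancels.\<close>

theorem levy_desplanques:
  fixes M :: "complex^'n^'n"
  assumes "det M = 0"
  obtains i where "cmod (M $ i $ i) \<le> off_diag_sum M i"
proof -
  have "\<not> invertible M"
    using assms by (simp add: invertible_det_nz)
  then obtain x where x: "M *v x = 0" "x \<noteq> 0"
    using invertible_left_inverse matrix_left_invertible_ker by blast
  obtain i where i: "\<And>j. cmod (x $ j) \<le> cmod (x $ i)"
  proof -
    have "Max (range (\<lambda>j. cmod (x $ j))) \<in> range (\<lambda>j. cmod (x $ j))"
      by (intro Max_in) auto
    then obtain i where "Max (range (\<lambda>j. cmod (x $ j))) = cmod (x $ i)"
      by blast
    then have "cmod (x $ j) \<le> cmod (x $ i)" for j
      by (metis Max_ge finite finite_imageI rangeI)
    then show ?thesis by (rule that)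
  qed
  have pos: "cmod (x $ i) > 0"
  proof (rule ccontr)
    assume "\<not> ?thesis"
    then have "x $ j = 0" for j
      using i[of j] by (metis norm_le_zero_iff not_less order_trans)
    with x show False by (simp add: vec_eq_iff)
  qed
  have "0 = (M *v x) $ i"
    by (simp add: x)
  also have "\<dots> = (\<Sum>j\<in>UNIV. M $ i $ j * x $ j)"
    by (simp add: matrix_vector_mult_def)
  also have "\<dots> = M $ i $ i * x $ i + (\<Sum>j\<in>UNIV - {i}. M $ i $ j * x $ j)"
    by (rule sum.remove) auto
  finally have "M $ i $ i * x $ i = - (\<Sum>j\<in>UNIV - {i}. M $ i $ j * x $ j)"
    by (simp add: eq_neg_iff_add_eq_0)
  then have "cmod (M $ i $ i) * cmod (x $ i) = cmod (\<Sum>j\<in>UNIV - {i}. M $ i $ j * x $ j)"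
    by (metis norm_minus_cancel norm_mult)
  also have "\<dots> \<le> (\<Sum>j\<in>UNIV - {i}. cmod (M $ i $ j) * cmod (x $ i))"
    by (intro sum_norm_le) (simp add: norm_mult i mult_left_mono)
  also have "\<dots> = off_diag_sum M i * cmod (x $ i)"
    by (simp add: off_diag_sum_def sum_distrib_right)
  finally have "cmod (M $ i $ i) \<le> off_diag_sum M i"
    using pos by simp
  then show ?thesis by (rule that)
qed

lemma off_diag_sum_pencil_le:
  "off_diag_sum (pencil A B z) i \<le> off_diag_sum A i + cmod z * off_diag_sum B i"
proof -
  have "cmod (A $ i $ j - z * B $ i $ j) \<le> cmod (A $ i $ j) + cmod z * cmod (B $ i $ j)" for j
    by (metis norm_mult norm_triangle_ineq4)
  then show ?thesis
    by (simp add: off_diag_sum_def pencil_def sum_distrib_left flip: sum.distrib) (intro sum_mono)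
qed

text \<open>Leading coefficients may vanish, so the degree is only bounded. The bound belongs to the
  induction: it kills the coefficient that the constant term of the next factor would
  multiply.\<close>

lemma coeff_prod_linear:
  fixes f :: "'a \<Rightarrow> 'b::comm_ring_1 poly"
  assumes "finite S" "\<And>i. i \<in> S \<Longrightarrow> degree (f i) \<le> 1"
  shows "degree (prod f S) \<le> card S \<and> coeff (prod f S) (card S) = (\<Prod>i\<in>S. coeff (f i) 1)"
  using assms
proof (induction S rule: finite_induct)
  case empty
  then show ?case by simp
next
  case (insert i S)
  have IH: "degree (prod f S) \<le> card S" "coeff (prod f S) (card S) = (\<Prod>i\<in>S. coeff (f i) 1)"
    using insert by auto
  have d: "degree (f i) \<le> 1"
    using insert by auto
  obtain u v where uv: "f i = [:u, v:]"
  proof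
    show "f i = [:coeff (f i) 0, coeff (f i) 1:]"
      using d by (intro poly_eqI) (auto simp: coeff_pCons coeff_eq_0 split: nat.split)
  qed
  have "degree (f i * prod f S) \<le> Suc (card S)"
    using d IH(1) degree_mult_le[of "f i" "prod f S"] by linarith
  moreover have "coeff (prod f S) (Suc (card S)) = 0"
    using IH(1) by (intro coeff_eq_0) simp
  ultimately show ?case
    using insert(1,2) IH(2) by (simp add: uv)
qed

text \<open>Every Leibniz term is a product of \<open>CARD('n)\<close> linear factors, so its top
  coefficient is the matching term of \<open>det (- B)\<close>.\<close>

lemma coeff_pencil_poly:
  fixes A B :: "complex^'n^'n"
  shows "coeff (pencil_poly A B) CARD('n) = det (- B)"
proof -
  have "coeff (\<Prod>i\<in>UNIV. [:A $ i $ p i, - (B $ i $ p i):]) CARD('n) = (\<Prod>i\<in>UNIV. - (B $ i $ p i))" for p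
    using coeff_prod_linear[of "UNIV :: 'n set" "\<lambda>i. [:A $ i $ p i, - (B $ i $ p i):]"]
    by simp
  then show ?thesis
    by (simp add: pencil_poly_def det_def coeff_sum of_int_poly)
qed

text \<open>Completing the square in \<open>cmod (z - a) = k * cmod z\<close> gives this circle. As
  an identity it serves both cases: the sign of \<open>1 - k\<^sup>2\<close> decides between disk
  and exterior.\<close>

lemma apollonius_identity:
  fixes z a :: complex and k :: real
  assumes "k\<^sup>2 \<noteq> 1"
  shows "(cmod (z - a / of_real (1 - k\<^sup>2)))\<^sup>2 - (cmod a * k / \<bar>1 - k\<^sup>2\<bar>)\<^sup>2
    = ((cmod (z - a))\<^sup>2 - (k * cmod z)\<^sup>2) / (1 - k\<^sup>2)"
proof -
  define d where "d = 1 - k\<^sup>2"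
  have d: "d \<noteq> 0" "k\<^sup>2 = 1 - d"
    using assms by (auto simp: d_def)
  have "(cmod (z - a / of_real d))\<^sup>2 - (cmod a * k / \<bar>d\<bar>)\<^sup>2
    = ((Re z - Re a / d)\<^sup>2 + (Im z - Im a / d)\<^sup>2) - ((Re a)\<^sup>2 + (Im a)\<^sup>2) * (1 - d) / d\<^sup>2"
    by (simp add: cmod_power2 power_mult_distrib power_divide d(2))
  also have "\<dots> = ((Re z - Re a)\<^sup>2 + (Im z - Im a)\<^sup>2 - (1 - d) * ((Re z)\<^sup>2 + (Im z)\<^sup>2)) / d"
  proof -
    have "x / d * d = x" for x
      using d(1) by simp
    moreover have "(X * d - P) ^ 2 / d ^ 2 = (X - P / d) ^ 2" for X P
      using d(1) by (simp add: diff_divide_distrib flip: power_divide)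
    ultimately show ?thesis
      using d(1) by (simp add: divide_simps) algebra
  qed
  also have "\<dots> = ((cmod (z - a))\<^sup>2 - (k * cmod z)\<^sup>2) / d"
    by (simp add: cmod_power2 power_mult_distrib d(2))
  finally show ?thesis
    by (simp add: d_def)
qed

lemma mem_Gamma_B:
  assumes "cmod (A $ i $ i - z * B $ i $ i) \<le> off_diag_sum A i + cmod z * off_diag_sum B i"
  shows "Fin z \<in> Gamma_B A B i"
proof (cases "row_sdd B i")
  case True
  define a b where "a = A $ i $ i" and "b = B $ i $ i"
  define r R where "r = off_diag_sum B i / cmod b" and "R = off_diag_sum A i"
  have b: "cmod b > 0" "r < 1" "0 \<le> r"
    using row_sdd_ratio[OF True] by (simp_all add: b_def r_def)
  have "a - z * b = b * (a / b - z)"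
    using b by (auto simp: field_simps)
  then have "cmod b * cmod (z - a / b) = cmod (a - z * b)"
    by (simp add: norm_mult norm_minus_commute)
  also have "\<dots> \<le> R + cmod z * (cmod b * r)"
    using assms b by (simp add: a_def b_def r_def R_def)
  also have "cmod z * (cmod b * r) \<le> (cmod (z - a / b) + cmod (a / b)) * (cmod b * r)"
    using b norm_triangle_sub[of z "a / b"] by (intro mult_right_mono) (auto simp: add.commute)
  also have "\<dots> = cmod (z - a / b) * cmod b * r + cmod a * r"
    using b by (simp add: norm_divide field_simps)
  \<comment> \<open>The term with \<open>cmod (z - a / b)\<close> on the right is absorbed into the
    left side.\<close>
  finally have "cmod (z - a / b) * (cmod b * (1 - r)) \<le> cmod a * r + R"
    by (simp add: algebra_simps)
  then have "cmod (z - a / b) \<le> (cmod a * r + R) / (cmod b * (1 - r))"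
    using b by (simp add: pos_le_divide_eq)
  then show ?thesis
    using True by (simp add: Gamma_B_def Let_def a_def b_def r_def R_def)
qed (simp add: Gamma_B_def)

lemma mem_Gamma_A:
  assumes "cmod (A $ i $ i - z * B $ i $ i) \<le> off_diag_sum A i + cmod z * off_diag_sum B i"
  shows "Fin z \<in> Gamma_A A B i"
proof (cases "row_sdd A i")
  case True
  define a b where "a = A $ i $ i" and "b = B $ i $ i"
  define r R where "r = off_diag_sum A i / cmod a" and "R = off_diag_sum B i"
  have a: "cmod a > 0" "r < 1" "0 \<le> r" and R: "0 \<le> R"
    using row_sdd_ratio[OF True] off_diag_sum_nonneg[of B i] by (simp_all add: a_def r_def R_def)
  have main: "cmod (a - z * b) \<le> cmod a * r + cmod z * R"
    using assms a by (simp add: a_def b_def r_def R_def)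
  show ?thesis
  proof (cases "b = 0")
    case b: True
    have pos: "0 < cmod a * (1 - r)"
      using a by simp
    have le: "cmod a * (1 - r) \<le> cmod z * R"
      using main b by (simp add: algebra_simps)
    \<comment> \<open>A finite \<open>z\<close> thus rules out the case where the region is only
      \<open>{Infty}\<close>.\<close>
    with pos have "R > 0"
      using R by (cases "R = 0") auto
    then have "cmod a / R * (1 - r) \<le> cmod z"
      using le by (simp add: field_simps)
    with True b \<open>R > 0\<close> show ?thesis
      by (simp add: Gamma_A_def Let_def a_def b_def r_def R_def)
  next
    case b: False
    define \<alpha> \<beta> where "\<alpha> = a / b" and "\<beta> = (cmod b * r + R) / (cmod b * (1 - r))"
    have \<beta>: "\<beta> \<ge> 0"
      using a R by (simp add: \<beta>_def)
    have a_eq: "a = \<alpha> * b"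
      using b by (simp add: \<alpha>_def)
    then have "a - z * b = b * (\<alpha> - z)"
      by (simp add: algebra_simps)
    then have "cmod b * cmod (z - \<alpha>) = cmod (a - z * b)"
      by (simp add: norm_mult norm_minus_commute)
    also have "\<dots> \<le> cmod \<alpha> * (cmod b * r) + cmod z * R"
      using main by (simp add: a_eq norm_mult mult.assoc)
    also have "cmod \<alpha> * (cmod b * r) \<le> (cmod (z - \<alpha>) + cmod z) * (cmod b * r)"
      using a norm_triangle_sub[of \<alpha> z]
      by (intro mult_right_mono) (auto simp: norm_minus_commute add.commute)
    finally have "cmod (z - \<alpha>) * (cmod b * (1 - r)) \<le> (cmod b * r + R) * cmod z"
      by (simp add: algebra_simps)
    then have le: "cmod (z - \<alpha>) \<le> \<beta> * cmod z"
      using a b by (simp add: \<beta>_def pos_le_divide_eq)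
    then have sq: "(cmod (z - \<alpha>))\<^sup>2 - (\<beta> * cmod z)\<^sup>2 \<le> 0"
      by (simp add: power_mono)
    define c \<rho> where "c = \<alpha> / of_real (1 - \<beta>\<^sup>2)" and "\<rho> = cmod \<alpha> * \<beta> / \<bar>1 - \<beta>\<^sup>2\<bar>"
    have \<rho>: "\<rho> \<ge> 0"
      using \<beta> by (simp add: \<rho>_def)
    have circle: "(cmod (z - c))\<^sup>2 - \<rho>\<^sup>2 = ((cmod (z - \<alpha>))\<^sup>2 - (\<beta> * cmod z)\<^sup>2) / (1 - \<beta>\<^sup>2)"
      if "\<beta> \<noteq> 1"
      unfolding c_def \<rho>_def using that \<beta> by (intro apollonius_identity) (simp add: power2_eq_1_iff)
    have "\<beta> < 1 \<Longrightarrow> cmod (z - c) \<le> \<rho>"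
    proof -
      assume "\<beta> < 1"
      then have "1 - \<beta>\<^sup>2 > 0" using \<beta> by (simp add: power_less_one_iff)
      then have "(cmod (z - c))\<^sup>2 - \<rho>\<^sup>2 \<le> 0"
        using circle \<open>\<beta> < 1\<close> sq by (simp add: divide_nonpos_pos)
      then show ?thesis using \<rho> by (simp add: power2_le_imp_le[of "cmod (z - c)" \<rho>])
    qed
    moreover have "\<beta> > 1 \<Longrightarrow> \<rho> \<le> cmod (z - c)"
    proof -
      assume "\<beta> > 1"
      \<comment> \<open>Dividing by this negative number reverses \<open>sq\<close>, hence the
        exterior of the circle.\<close>
      then have "1 - \<beta>\<^sup>2 < 0" by (simp add: one_less_power)
      then have "(cmod (z - c))\<^sup>2 - \<rho>\<^sup>2 \<ge> 0"
        using circle \<open>\<beta> > 1\<close> sq by (simp add: divide_nonpos_neg)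
      then show ?thesis by (simp add: power2_le_imp_le[of \<rho> "cmod (z - c)"])
    qed
    moreover have "\<beta> = 1 \<Longrightarrow> cmod (z - \<alpha>) \<le> cmod z"
      using le by simp
    ultimately show ?thesis
      using True b unfolding Gamma_A_def Let_def c_def \<rho>_def \<alpha>_def \<beta>_def a_def b_def r_def R_def
      by auto
  qed
qed (simp add: Gamma_A_def)

text \<open>Only the disk case, with nonzero diagonal entry and \<open>\<beta> < 1\<close>, leaves
  out \<open>Infty\<close>. A row of \<open>B\<close> that is not dominant has
  \<open>R \<ge> cmod b\<close>, which forces \<open>\<beta> \<ge> 1\<close>.\<close>

lemma Infty_mem_Gamma_A:
  assumes "cmod (B $ i $ i) \<le> off_diag_sum B i"
  shows "Infty \<in> Gamma_A A B i"
proof (cases "row_sdd A i \<and> B $ i $ i \<noteq> 0")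
  case True
  define b r R where "b = B $ i $ i" and "r = off_diag_sum A i / cmod (A $ i $ i)"
    and "R = off_diag_sum B i"
  have r: "0 \<le> r" "r < 1" and b: "0 < cmod b" "b \<noteq> 0"
    using True row_sdd_ratio[of A i] by (simp_all add: r_def b_def)
  have "cmod b * (1 - r) \<le> cmod b"
    using r by (intro mult_left_le) auto
  also have "\<dots> \<le> cmod b * r + R"
    using assms r by (simp add: b_def R_def add_increasing)
  finally have "\<not> (cmod b * r + R) / (cmod b * (1 - r)) < 1"
    using r b by (simp add: not_less)
  with True show ?thesis
    unfolding Gamma_A_def Let_def b_def r_def R_def by auto
qed (auto simp: Gamma_A_def Let_def)

theorem theorem2p3:
  fixes A B :: "complex^'n^'n" and l :: ext_complex
  assumes "\<And>i. row_sdd A i \<or> row_sdd B i"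
    and "pencil_eigenvalue A B l"
  shows "l \<in> (\<Union>i. Gamma_region A B i)"
proof (cases l)
  case (Fin z)
  then obtain i where "cmod (pencil A B z $ i $ i) \<le> off_diag_sum (pencil A B z) i"
    using assms(2) levy_desplanques[of "pencil A B z"] by auto
  also note off_diag_sum_pencil_le
  finally have "cmod (A $ i $ i - z * B $ i $ i) \<le> off_diag_sum A i + cmod z * off_diag_sum B i"
    by (simp add: pencil_def)
  \<comment> \<open>One index \<open>i\<close> serves both regions, as their intersection
    requires.\<close>
  then show ?thesis
    using Fin mem_Gamma_A[of A i z B] mem_Gamma_B[of A i z B] by (auto simp: Gamma_region_def)
next
  case Infty
  then have "det (- B) = 0"
    using assms(2) by (simp flip: coeff_pencil_poly[of A] add: coeff_eq_0)
  then obtain i where "cmod ((- B) $ i $ i) \<le> off_diag_sum (- B) i"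
    by (rule levy_desplanques)
  then have i: "cmod (B $ i $ i) \<le> off_diag_sum B i"
    by (simp add: off_diag_sum_def)
  \<comment> \<open>Row \<open>i\<close> of \<open>B\<close> is not strictly dominant, so the region
    is the whole extended plane.\<close>
  then have "Infty \<in> Gamma_B A B i"
    by (simp add: Gamma_B_def row_sdd_def)
  then show ?thesis
    using Infty Infty_mem_Gamma_A[OF i] by (auto simp: Gamma_region_def)
qed

end
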